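(* Let $\lambda>-1$ and $t\in\mathbb{R}$, and let $P_n(x)=P_n(x;t,\lambda)$, $n\ge 0$, be the monic orthogonal polynomials with respect to the generalised Airy weight $\omega(x;t,\lambda)=x^{\lambda}\exp(-\tfrac13x^3+tx)$ on $(0,\infty)$, with three-term recurrence coefficients $\alpha_n=\alpha_n(t;\lambda)$ and $\beta_n=\beta_n(t;\lambda)$. Then for every $n\ge 0$ the differential-difference equation $$\frac{\mathrm{d}P_n}{\mathrm{d}x}(x)=\beta_n A_n(x)P_{n-1}(x)-B_n(x)P_n(x)$$ holds (as an identity of rational functions of $x$), where $$A_n(x)=x+\alpha_n+\frac{R_n}{x},\qquad B_n(x)=\beta_n+\frac{r_n}{x},$$ with $$R_n=\alpha_n^2+\beta_n+\beta_{n+1}-t,$$ $$r_n=\tfrac12\left(\lambda-\alpha_{n+1}\beta_{n+1}+\alpha_{n-1}\beta_n-\alpha_n^3+t\alpha_n+1\right)-\alpha_n\beta_{n+1}.$$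
   Context: The generalised Airy weight is $\omega(x;t,\lambda)=x^{\lambda}\exp(-\tfrac13x^3+tx)$, $x\in(0,\infty)$, $\lambda>-1$, $t\in\mathbb{R}$. $P_n(x;t,\lambda)$ is the monic polynomial of degree $n$ with $\int_0^\infty P_m(x;t,\lambda)P_n(x;t,\lambda)\,\omega(x;t,\lambda)\,\mathrm{d}x=0$ for $m\ne n$. The recurrence coefficients $\alpha_n(t;\lambda)$, $\beta_n(t;\lambda)$ are defined by $xP_n(x)=P_{n+1}(x)+\alpha_nP_n(x)+\beta_nP_{n-1}(x)$ with $P_{-1}=0$, $P_0=1$ (so $\beta_n>0$ for $n\ge1$), with the conventions $\beta_0=0$ and $\alpha_{-1}=\beta_{-1}=0$. *)

theory Defs
  imports "HOL-Analysis.Analysis" "HOL-Computational_Algebra.Polynomial"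
begin

text \<open>Only ever used for \<open>x > 0\<close>, where \<open>powr\<close> is the usual real power.\<close>

definition airy_weight :: "real \<Rightarrow> real \<Rightarrow> real \<Rightarrow> real" where
  "airy_weight t lam x = x powr lam * exp (- (x ^ 3) / 3 + t * x)"

text \<open>For \<open>lam > -1\<close> all the integrals below converge absolutely, so the value \<open>0\<close> never
  stems from the convention that the Bochner integral of a non-integrable function is \<open>0\<close>.\<close>

definition airy_orthogonal_polys :: "real \<Rightarrow> real \<Rightarrow> (nat \<Rightarrow> real poly) \<Rightarrow> bool" where
  "airy_orthogonal_polys t lam P \<longleftrightarrow>
     (\<forall>n. degree (P n) = n \<and> lead_coeff (P n) = 1) \<and>
     (\<forall>m n. m \<noteq> n \<longrightarrow>
        (LBINT x:{0<..}. poly (P m) x * poly (P n) x * airy_weight t lam x) = 0)"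

text \<open>\<open>prev f n\<close> is the term of index \<open>n - 1\<close>, with the convention that the term of
  index \<open>-1\<close> is \<open>0\<close>.\<close>

definition prev :: "(nat \<Rightarrow> 'a::zero) \<Rightarrow> nat \<Rightarrow> 'a" where
  "prev f n = (case n of 0 \<Rightarrow> 0 | Suc k \<Rightarrow> f k)"

text \<open>The recurrence says nothing about \<open>beta 0\<close>, as it is multiplied by \<open>prev P 0 = 0\<close>;
  its value is a convention.\<close>

definition recurrence_coeffs ::
    "(nat \<Rightarrow> real poly) \<Rightarrow> (nat \<Rightarrow> real) \<Rightarrow> (nat \<Rightarrow> real) \<Rightarrow> bool" where
  "recurrence_coeffs P alpha beta \<longleftrightarrow>
     beta 0 = 0 \<and>
     (\<forall>n. [:0, 1:] * P n = P (Suc n) + smult (alpha n) (P n) + smult (beta n) (prev P n))"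

definition ladder_R :: "real \<Rightarrow> (nat \<Rightarrow> real) \<Rightarrow> (nat \<Rightarrow> real) \<Rightarrow> nat \<Rightarrow> real" where
  "ladder_R t alpha beta n = (alpha n)\<^sup>2 + beta n + beta (n + 1) - t"

definition ladder_r :: "real \<Rightarrow> real \<Rightarrow> (nat \<Rightarrow> real) \<Rightarrow> (nat \<Rightarrow> real) \<Rightarrow> nat \<Rightarrow> real" where
  "ladder_r t lam alpha beta n =
     1 / 2 * (lam - alpha (n + 1) * beta (n + 1) + prev alpha n * beta n
              - alpha n ^ 3 + t * alpha n + 1)
     - alpha n * beta (n + 1)"

definition ladder_A ::
    "real \<Rightarrow> (nat \<Rightarrow> real) \<Rightarrow> (nat \<Rightarrow> real) \<Rightarrow> nat \<Rightarrow> real \<Rightarrow> real" where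
  "ladder_A t alpha beta n x = x + alpha n + ladder_R t alpha beta n / x"

definition ladder_B ::
    "real \<Rightarrow> real \<Rightarrow> (nat \<Rightarrow> real) \<Rightarrow> (nat \<Rightarrow> real) \<Rightarrow> nat \<Rightarrow> real \<Rightarrow> real" where
  "ladder_B t lam alpha beta n x = beta n + ladder_r t lam alpha beta n / x"

end

theory Submission
  imports Defs "HOL-Real_Asymp.Real_Asymp"
begin

text \<open>
  Write \<open>L p\<close> for the integral of \<open>p\<close> against the weight \<open>w\<close>. The weight satisfies the Pearson
  equation \<open>(x w)' = (lam + 1 + t x - x^3) w\<close>, so integrating \<open>(x p w)'\<close> over the half line, where the
  boundary terms vanish because \<open>lam > -1\<close>, gives
  \<open>L (x p') = L (p (x^3 - t x - lam - 1))\<close> for every polynomial \<open>p\<close> (\<open>airy_functional_pderiv\<close>). This is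
  the only information about the weight that enters, apart from linearity and positivity of \<open>L\<close>.

  Apply it to \<open>p = P_n q\<close> with \<open>deg q < n\<close>. As \<open>x q'\<close> and \<open>q\<close> are orthogonal to \<open>P_n\<close>, it says that
  \<open>x P_n'\<close> and \<open>S = (x^3 - t x) P_n\<close> have the same products with all \<open>q\<close> of degree below \<open>n\<close>.
  Hence \<open>x P_n' = n P_n + V\<close>, where \<open>V\<close> is the part of degree below \<open>n\<close> in the expansion
  \<open>S = V + d P_n + U\<close> of \<open>S\<close> in the basis \<open>(P_k)\<close>, with \<open>U\<close> a combination of \<open>P_(n+1)\<close>, \<open>P_(n+2)\<close> and
  \<open>P_(n+3)\<close>. The three-term recurrence makes this expansion explicit. A priori \<open>V\<close> is a combination of
  \<open>P_(n-1)\<close>, \<open>P_(n-2)\<close> and \<open>P_(n-3)\<close>; eliminating the last two by the recurrence turns it into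
  \<open>beta_n ((x^2 + alpha_n x + R_n) P_(n-1) - (x + alpha_n + alpha_(n-1)) P_n)\<close>, which produces \<open>A_n\<close>
  and the polynomial part of \<open>B_n\<close>.

  What remains is the coefficient \<open>n - beta_n (alpha_n + alpha_(n-1))\<close> of \<open>P_n\<close>, which has to be
  \<open>- r_n\<close>. The formula for \<open>r_n\<close> does not mention \<open>n\<close>: the identity for \<open>p = P_n^2\<close>
  gives \<open>2 n L (P_n^2) = (d - lam - 1) L (P_n^2)\<close>, and this eliminates \<open>n\<close>.
\<close>

section \<open>The moment functional of the weight\<close>

definition airy_functional :: "real \<Rightarrow> real \<Rightarrow> real poly \<Rightarrow> real" where
  "airy_functional t lam p = (LBINT x:{0<..}. poly p x * airy_weight t lam x)"

lemma set_integrable_powr_exp: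
  fixes a :: real
  assumes "a > -1"
  shows "set_integrable lborel {0<..} (\<lambda>x. x powr a * exp (- x))"
proof -
  have "(\<integral>\<^sup>+x. ennreal (indicator {0..} x * x powr a / exp x) \<partial>lborel) = ennreal (Gamma (a + 1))"
    using Gamma_conv_nn_integral_real[of "a + 1"] assms by simp
  then have "integrable lborel (\<lambda>x. indicator {0..} x * x powr a / exp x)"
    by (intro integrableI_nonneg) auto
  then have "set_integrable lborel {0..} (\<lambda>x. x powr a * exp (- x))"
    unfolding set_integrable_def by (simp add: exp_minus divide_inverse mult.assoc)
  then show ?thesis
    by (rule set_integrable_subset) auto
qed

text \<open>The cubic term dominates any linear one, so \<open>exp (- x^3/3 + t x)\<close> is bounded by a multiple of
  \<open>exp (- x)\<close>. The explicit bound comes from the observation that the left-hand side is positive only when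
  \<open>x\<^sup>2 < 3 * \<bar>c\<bar>\<close>, and then \<open>x \<le> 1 + x\<^sup>2\<close> bounds \<open>x\<close>.\<close>

lemma airy_exponent_bounded:
  fixes c x :: real
  assumes "x > 0"
  shows "c * x - x ^ 3 / 3 \<le> \<bar>c\<bar> * (1 + 3 * \<bar>c\<bar>)"
proof (cases "x\<^sup>2 \<le> 3 * \<bar>c\<bar>")
  case True
  have "0 \<le> (x - 1)\<^sup>2" by simp
  then have "x \<le> 1 + x\<^sup>2" using assms by (simp add: power2_eq_square algebra_simps)
  with True have "x \<le> 1 + 3 * \<bar>c\<bar>" by linarith
  then have "\<bar>c\<bar> * x \<le> \<bar>c\<bar> * (1 + 3 * \<bar>c\<bar>)" by (rule mult_left_mono) simp
  moreover have "c * x \<le> \<bar>c\<bar> * x" using assms by (intro mult_right_mono) auto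
  moreover have "x ^ 3 / 3 \<ge> 0" using assms by simp
  ultimately show ?thesis by linarith
next
  case False
  have "c * x - x ^ 3 / 3 = x * (c - x\<^sup>2 / 3)"
    by (simp add: algebra_simps power2_eq_square power3_eq_cube)
  also have "\<dots> \<le> 0" using assms False by (intro mult_nonneg_nonpos) auto
  also have "\<dots> \<le> \<bar>c\<bar> * (1 + 3 * \<bar>c\<bar>)" by simp
  finally show ?thesis .
qed

lemma set_integrable_airy_weight:
  assumes "lam > -1"
  shows "set_integrable lborel {0<..} (airy_weight t lam)"
proof -
  define C where "C = exp (\<bar>t + 1\<bar> * (1 + 3 * \<bar>t + 1\<bar>))"
  have "set_integrable lborel {0<..} (\<lambda>x. C * (x powr lam * exp (- x)))"
    by (intro set_integrable_mult_right set_integrable_powr_exp assms)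
  then show ?thesis
  proof (rule set_integrable_bound)
    show "set_borel_measurable lborel {0<..} (airy_weight t lam)"
      unfolding set_borel_measurable_def airy_weight_def by measurable
    have "norm (airy_weight t lam x) \<le> norm (C * (x powr lam * exp (- x)))" if "x > 0" for x
    proof -
      have "airy_weight t lam x = exp ((t + 1) * x - x ^ 3 / 3) * (x powr lam * exp (- x))"
        unfolding airy_weight_def by (simp add: algebra_simps flip: exp_add)
      also have "\<dots> \<le> C * (x powr lam * exp (- x))"
        unfolding C_def using airy_exponent_bounded[OF that, of "t + 1"]
        by (intro mult_right_mono) auto
      finally show ?thesis by (simp add: airy_weight_def C_def)
    qed
    then show "AE x in lborel. x \<in> {0<..} \<longrightarrow>
        norm (airy_weight t lam x) \<le> norm (C * (x powr lam * exp (- x)))"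
      by auto
  qed
qed

text \<open>Powers of \<open>x\<close> merely shift the parameter \<open>lam\<close>, so that facts about the weight itself yield the
  corresponding facts about all monomials, and by linearity about all polynomials.\<close>

lemma power_mult_airy_weight:
  assumes "x > 0"
  shows "x ^ k * airy_weight t lam x = airy_weight t (lam + real k) x"
  using assms by (simp add: airy_weight_def powr_add powr_realpow)

lemma set_integrable_poly_airy_weight:
  assumes "lam > -1"
  shows "set_integrable lborel {0<..} (\<lambda>x. poly p x * airy_weight t lam x)"
proof -
  have "set_integrable lborel {0<..} (\<lambda>x. \<Sum>i\<in>{..degree p}. coeff p i * airy_weight t (lam + real i) x)"
    using assms set_integrable_airy_weight[of "lam + real _" t] unfolding set_integrable_def scaleR_sum_right
    by (intro Bochner_Integration.integrable_sum) (simp add: mult.left_commute)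
  also have "?this \<longleftrightarrow> ?thesis"
    by (intro set_integrable_cong)
       (auto simp: poly_altdef sum_distrib_right mult.assoc power_mult_airy_weight)
  finally show ?thesis .
qed

lemma airy_functional_add:
  assumes "lam > -1"
  shows "airy_functional t lam (p + q) = airy_functional t lam p + airy_functional t lam q"
  unfolding airy_functional_def poly_add distrib_right
  by (intro set_integral_add set_integrable_poly_airy_weight assms)

lemma airy_functional_smult: "airy_functional t lam (smult c p) = c * airy_functional t lam p"
  by (simp add: airy_functional_def mult.assoc)

lemma airy_functional_0 [simp]: "airy_functional t lam 0 = 0"
  by (simp add: airy_functional_def set_lebesgue_integral_def)

lemma airy_functional_diff:
  assumes "lam > -1"
  shows "airy_functional t lam (p - q) = airy_functional t lam p - airy_functional t lam q"
  using airy_functional_add[OF assms, of t "p - q" q] by simp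

text \<open>Definiteness: the integrand \<open>p\<^sup>2 w\<close> is nonnegative, so it vanishes almost everywhere, while \<open>w\<close> is
  positive and a nonzero \<open>p\<close> has only finitely many roots.\<close>

lemma airy_functional_square_eq_0:
  assumes "lam > -1" and zero: "airy_functional t lam (p * p) = 0"
  shows "p = 0"
proof (rule ccontr)
  assume "p \<noteq> 0"
  let ?f = "\<lambda>x. indicator {0<..} x *\<^sub>R (poly (p * p) x * airy_weight t lam x)"
  have "integrable lborel ?f"
    using set_integrable_poly_airy_weight[OF assms(1), of "p * p" t]
    by (simp only: set_integrable_def)
  moreover have "AE x in lborel. 0 \<le> ?f x"
    by (auto simp: airy_weight_def)
  moreover have "integral\<^sup>L lborel ?f = 0"
    using zero by (simp add: airy_functional_def set_lebesgue_integral_def)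
  ultimately have "AE x in lborel. ?f x = 0"
    using integral_nonneg_eq_0_iff_AE by blast
  then have "AE x in lborel. x \<notin> {0<..} \<or> poly p x = 0"
    by eventually_elim (auto simp: airy_weight_def indicator_def split: if_splits)
  moreover have "AE x in lborel. x \<notin> {x. poly p x = 0}"
    using poly_roots_finite[OF \<open>p \<noteq> 0\<close>]
    by (intro AE_not_in null_setsI) (auto simp: emeasure_lborel_countable countable_finite finite_imp_closed)
  ultimately have "AE x in lborel. x \<notin> {0<..<1::real}"
    by eventually_elim auto
  then have "emeasure lborel {0<..<1::real} = 0"
    by (subst (asm) AE_iff_measurable[of "{0<..<1}"]) auto
  then show False by simp
qed

section \<open>Integration by parts\<close>

text \<open>The integrand is the derivative of \<open>x powr (a + 1) * exp (- x^3/3 + t x)\<close>, which tends to \<open>0\<close> at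
  both ends of the half line.\<close>

lemma airy_moment_recurrence:
  assumes "a > -1"
  shows "airy_functional t a [:a + 1, t, 0, -1:] = 0"
proof -
  define F where "F x = x powr (a + 1) * exp (- (x ^ 3) / 3 + t * x)" for x :: real
  define f where "f x = poly [:a + 1, t, 0, -1:] x * airy_weight t a x" for x
  have eq: "einterval 0 \<infinity> = {0<..}"
    by (auto simp: einterval_def)
  have deriv: "(F has_vector_derivative f x) (at x)" if "x > 0" for x
  proof -
    have powr: "x powr (1 + a) = x * x powr a"
      using that by (simp add: powr_add)
    have "(F has_real_derivative f x) (at x)"
      unfolding F_def f_def airy_weight_def using that
      by (auto intro!: derivative_eq_intros simp: powr algebra_simps power2_eq_square)
    then show ?thesis by (simp add: has_real_derivative_iff_has_vector_derivative)
  qed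
  have cont: "isCont f x" if "x > 0" for x
    unfolding f_def airy_weight_def using that by (intro continuous_intros) auto
  have "(LBINT x=0..\<infinity>. f x) = 0 - 0"
  proof (rule interval_integral_FTC_integrable[where F = F])
    show "set_integrable lborel (einterval 0 \<infinity>) f"
      unfolding eq f_def by (rule set_integrable_poly_airy_weight[OF assms])
    have "(F \<longlongrightarrow> 0) (at_right 0)"
      using assms unfolding F_def by real_asymp
    then show "((F \<circ> real_of_ereal) \<longlongrightarrow> 0) (at_right 0)"
      by (simp add: zero_ereal_def ereal_tendsto_simps)
    have "(F \<longlongrightarrow> 0) at_top"
      unfolding F_def by real_asymp
    then show "((F \<circ> real_of_ereal) \<longlongrightarrow> 0) (at_left \<infinity>)"
      by (simp add: ereal_tendsto_simps)
  qed (use deriv cont in auto)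
  then show ?thesis
    by (simp add: airy_functional_def f_def interval_lebesgue_integral_def eq)
qed

text \<open>The Pearson equation of the weight in integrated form. For \<open>p = x^k\<close> it is the preceding moment
  identity at parameter \<open>lam + k\<close>, and both sides are linear in \<open>p\<close>.\<close>

lemma airy_functional_pderiv:
  assumes "lam > -1"
  shows "airy_functional t lam ([:0, 1:] * pderiv p) =
    airy_functional t lam (p * [:- lam - 1, - t, 0, 1:])"
proof -
  define D where "D p = [:0, 1:] * pderiv p - p * [:- lam - 1, - t, 0, 1:]" for p :: "real poly"
  have D_add: "D (p + q) = D p + D q" for p q
    by (simp only: D_def pderiv_add distrib_left distrib_right add_diff_add)
  have monom: "airy_functional t lam (D (monom c k)) = 0" for c k
  proof -
    have *: "poly (D (monom c k)) x = c * (x ^ k * poly [:(lam + real k) + 1, t, 0, -1:] x)" for x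
      by (cases k) (simp_all add: D_def pderiv_monom poly_monom algebra_simps)
    have "airy_functional t lam (D (monom c k)) =
        (LBINT x:{0<..}. c * (poly [:(lam + real k) + 1, t, 0, -1:] x * airy_weight t (lam + real k) x))"
      unfolding airy_functional_def *
      by (intro set_lebesgue_integral_cong) (auto simp flip: power_mult_airy_weight)
    also have "\<dots> = c * airy_functional t (lam + real k) [:(lam + real k) + 1, t, 0, -1:]"
      by (simp only: airy_functional_def set_integral_mult_right)
    also have "\<dots> = 0"
      using airy_moment_recurrence[of "lam + real k" t] assms by simp
    finally show ?thesis .
  qed
  have sum: "airy_functional t lam (D (\<Sum>i\<in>A. monom (coeff p i) i)) = 0" if "finite A" for A
    using that
  proof induction
    case empty
    then show ?case by (simp add: D_def)
  qed (simp add: D_add airy_functional_add[OF assms] monom)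
  have "airy_functional t lam (D p) = 0"
    using sum[of "{..degree p}"] by (simp add: poly_as_sum_of_monoms)
  then show ?thesis
    by (simp add: D_def airy_functional_diff[OF assms])
qed

section \<open>The ladder relation\<close>

text \<open>Any polynomial of degree below \<open>m\<close> is a combination of \<open>P 0, \<dots>, P (m - 1)\<close>; the induction
  removes the leading term with a multiple of \<open>P (m - 1)\<close>. Phrasing the degree bound by coefficients lets
  the zero polynomial satisfy it even for \<open>m = 0\<close>.\<close>

lemma airy_functional_orthogonal_lower:
  assumes "lam > -1" and P: "airy_orthogonal_polys t lam P"
    and "m \<le> n" and "\<And>i. i \<ge> m \<Longrightarrow> coeff q i = 0"
  shows "airy_functional t lam (P n * q) = 0"
  using assms(3,4)
proof (induction m arbitrary: q)
  case 0
  then have "q = 0" by (simp add: poly_eq_iff)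
  then show ?case by simp
next
  case (Suc m)
  define c where "c = coeff q m"
  have deg: "degree (P m) = m" "coeff (P m) m = 1"
    using P unfolding airy_orthogonal_polys_def by metis+
  have "airy_functional t lam (P n * (q - smult c (P m))) = 0"
  proof (rule Suc.IH)
    show "coeff (q - smult c (P m)) i = 0" if "i \<ge> m" for i
    proof (cases "i = m")
      case True
      then show ?thesis using deg by (simp add: c_def)
    next
      case False
      then show ?thesis using that deg Suc.prems(2) by (simp add: coeff_eq_0)
    qed
  qed (use Suc.prems in simp)
  moreover have "airy_functional t lam (P n * P m) = 0"
    using P Suc.prems(1) by (auto simp: airy_orthogonal_polys_def airy_functional_def mult.assoc)
  ultimately show ?case
    by (simp add: right_diff_distrib airy_functional_diff[OF assms(1)] airy_functional_smult)
qed

text \<open>The ladder relation multiplied by \<open>x\<close>, as an identity of polynomials. In the proof, \<open>W\<close> is the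
  difference of the two sides of \<open>x P_n' = n P_n + V\<close>. It has degree below \<open>n\<close> and is orthogonal to
  every polynomial of degree below \<open>n\<close>, in particular to itself, so it vanishes.\<close>

lemma airy_structure_relation:
  fixes t lam :: real and P alpha beta
  assumes lam: "lam > -1" and P: "airy_orthogonal_polys t lam P"
    and rec: "recurrence_coeffs P alpha beta"
  shows "[:0, 1:] * pderiv (P n) =
    smult (beta n) ([:ladder_R t alpha beta n, alpha n, 1:] * prev P n)
    - smult (ladder_r t lam alpha beta n) (P n) - smult (beta n) ([:0, 1:] * P n)"
proof -
  define d where "d = alpha n ^ 3 + 2 * alpha n * beta (Suc n) + alpha (Suc n) * beta (Suc n)
    + 2 * alpha n * beta n + prev alpha n * beta n - t * alpha n"
  define V where "V = smult (beta n) ([:ladder_R t alpha beta n, alpha n, 1:] * prev P n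
    - [:alpha n + prev alpha n, 1:] * P n)"
  define u1 where "u1 = beta (Suc (Suc n)) + (alpha (Suc n))\<^sup>2 + beta (Suc n)
    + alpha n * alpha (Suc n) + (alpha n)\<^sup>2 - t + beta n"
  define u2 where "u2 = alpha (Suc (Suc n)) + alpha (Suc n) + alpha n"
  define U where "U = smult u1 (P (Suc n)) + smult u2 (P (Suc (Suc n))) + P (Suc (Suc (Suc n)))"
  define S where "S = [:0, -t, 0, 1:] * P n"
  define W where "W = [:0, 1:] * pderiv (P n) - smult (real n) (P n) - V"
  note L_simps = airy_functional_add[OF lam] airy_functional_diff[OF lam] airy_functional_smult
  note orth = airy_functional_orthogonal_lower[OF lam P]
  have deg: "degree (P m) = m" and lead: "coeff (P m) m = 1" for m
    using P unfolding airy_orthogonal_polys_def by metis+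
  have step: "[:0, 1:] * P m = P (Suc m) + smult (alpha m) (P m) + smult (beta m) (prev P m)" for m
    using rec by (simp add: recurrence_coeffs_def)
  have beta0: "beta 0 = 0"
    using rec by (simp add: recurrence_coeffs_def)

  \<comment> \<open>Repeated use of the recurrence at \<open>n\<close>, \<open>n + 1\<close> and \<open>n + 2\<close>; \<open>d\<close> is the diagonal entry at
    \<open>n\<close> of \<open>J^3 - t J\<close> for the Jacobi matrix \<open>J\<close> of multiplication by \<open>x\<close>.\<close>
  have S_eq: "S = V + smult d (P n) + U"
  proof -
    have pt: "x * poly (P m) x = poly (P (Suc m)) x + alpha m * poly (P m) x + beta m * poly (prev P m) x"
      for x m using arg_cong[OF step[of m], of "\<lambda>p. poly p x"] by simp
    have "poly S x = poly (V + smult d (P n) + U) x" for x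
      using pt[of x n] pt[of x "Suc n"] pt[of x "Suc (Suc n)"]
      unfolding S_def V_def U_def u1_def u2_def d_def ladder_R_def
      by (simp add: prev_def[of P "Suc _"]) algebra
    then show ?thesis by (simp add: poly_eq_poly_eq_iff[symmetric] fun_eq_iff)
  qed

  \<comment> \<open>Both products in the definition of \<open>V\<close> have degree \<open>n + 1\<close>. Expressing \<open>P_n\<close> by \<open>P_(n-1)\<close> and \<open>P_(n-2)\<close>
    reveals that the terms of degree \<open>n + 1\<close> and \<open>n\<close> cancel.\<close>
  have V_low: "coeff V i = 0" if "i \<ge> n" for i
  proof (cases n)
    case 0
    then show ?thesis by (simp add: V_def beta0)
  next
    case (Suc m)
    define k where "k = ladder_R t alpha beta n + alpha m * (alpha n + alpha m)"
    have V_eq: "V = smult (beta n) (smult k (P m) + smult (beta m) ([:alpha n + alpha m, 1:] * prev P m))"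
    proof -
      have "poly V x = poly (smult (beta n) (smult k (P m)
          + smult (beta m) ([:alpha n + alpha m, 1:] * prev P m))) x" for x
        using arg_cong[OF step[of m], of "\<lambda>p. poly p x"]
        unfolding V_def k_def Suc
        by (simp add: prev_def[of _ "Suc _"]) algebra
      then show ?thesis by (simp add: poly_eq_poly_eq_iff[symmetric] fun_eq_iff)
    qed
    have "coeff (P m) i = 0" using that Suc by (simp add: coeff_eq_0 deg)
    moreover have "coeff (smult (beta m) ([:alpha n + alpha m, 1:] * prev P m)) i = 0"
    proof (cases m)
      case (Suc l)
      then show ?thesis using that \<open>n = Suc m\<close>
        by (cases i) (auto simp: prev_def coeff_eq_0 deg)
    qed (simp add: beta0)
    ultimately show ?thesis by (simp add: V_eq)
  qed

  \<comment> \<open>\<open>P_n\<close> is monic of degree \<open>n\<close>, so \<open>x P_n'\<close> has leading coefficient \<open>n\<close>.\<close>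
  have W_low: "coeff W i = 0" if "i \<ge> n" for i
  proof -
    have "coeff ([:0, 1:] * pderiv (P n)) i = real i * coeff (P n) i"
      by (cases i) (simp_all add: coeff_pderiv)
    moreover have "i = n \<or> coeff (P n) i = 0"
      using that by (cases "i = n") (auto simp: coeff_eq_0 deg)
    ultimately show ?thesis using V_low[OF that] by (auto simp: W_def)
  qed

  have U_orth: "airy_functional t lam (U * q) = 0" if "\<And>i. i \<ge> Suc n \<Longrightarrow> coeff q i = 0" for q
    using orth[of "Suc n" _ q] that by (simp add: U_def distrib_right L_simps)

  have W_orth: "airy_functional t lam (W * q) = 0" if q: "\<And>i. i \<ge> n \<Longrightarrow> coeff q i = 0" for q
  proof -
    have Pq: "airy_functional t lam (P n * q) = 0"
      using orth[of n n q] q by simp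
    have "airy_functional t lam (P n * ([:0, 1:] * pderiv q)) = 0"
    proof (rule orth[of n n])
      show "coeff ([:0, 1:] * pderiv q) i = 0" if "i \<ge> n" for i
        using q[of i] that by (cases i) (simp_all add: coeff_pderiv)
    qed simp
    moreover have "[:0, 1:] * pderiv (P n * q) =
        [:0, 1:] * pderiv (P n) * q + P n * ([:0, 1:] * pderiv q)"
      by (simp add: pderiv_mult algebra_simps)
    ultimately have "airy_functional t lam ([:0, 1:] * pderiv (P n) * q) =
        airy_functional t lam (P n * q * [:- lam - 1, - t, 0, 1:])"
      using airy_functional_pderiv[OF lam, of t "P n * q"] by (simp only: L_simps)
    also have "P n * q * [:- lam - 1, - t, 0, 1:] = S * q - smult (lam + 1) (P n * q)"
      unfolding poly_eq_poly_eq_iff[symmetric] fun_eq_iff S_def by (simp add: algebra_simps)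
    also have "airy_functional t lam \<dots> = airy_functional t lam (V * q)"
      using Pq U_orth[of q] q by (simp add: S_eq distrib_right L_simps)
    finally show ?thesis
      using Pq by (simp add: W_def left_diff_distrib L_simps)
  qed
  have "W = 0"
    using airy_functional_square_eq_0[OF lam W_orth] W_low by blast
  then have xdP: "[:0, 1:] * pderiv (P n) = smult (real n) (P n) + V"
    by (simp add: W_def algebra_simps)

  \<comment> \<open>Integration by parts for \<open>P_n^2\<close>, evaluated on the left by \<open>x P_n' = n P_n + V\<close> and on the right
    by \<open>S = V + d P_n + U\<close>.\<close>
  have n_eq: "2 * real n = d - lam - 1"
  proof -
    have PV: "airy_functional t lam (P n * V) = 0"
      using orth[of n n V] V_low by simp
    have PU: "airy_functional t lam (P n * U) = 0"
      using U_orth[of "P n"] by (simp add: coeff_eq_0 deg mult.commute)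
    have "[:0, 1:] * pderiv (P n * P n) = smult 2 (P n * ([:0, 1:] * pderiv (P n)))"
      unfolding poly_eq_poly_eq_iff[symmetric] fun_eq_iff by (simp add: pderiv_mult algebra_simps)
    also have "\<dots> = smult (2 * real n) (P n * P n) + smult 2 (P n * V)"
      by (simp only: xdP) (simp add: algebra_simps smult_add_right)
    finally have lhs: "airy_functional t lam ([:0, 1:] * pderiv (P n * P n)) =
        2 * real n * airy_functional t lam (P n * P n)"
      by (simp add: L_simps PV)
    have "P n * P n * [:- lam - 1, - t, 0, 1:] = P n * S - smult (lam + 1) (P n * P n)"
      unfolding poly_eq_poly_eq_iff[symmetric] fun_eq_iff S_def by (simp add: algebra_simps)
    also have "\<dots> = P n * V + P n * U + smult (d - lam - 1) (P n * P n)"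
      unfolding poly_eq_poly_eq_iff[symmetric] fun_eq_iff S_eq by (simp add: algebra_simps)
    finally have "airy_functional t lam (P n * P n * [:- lam - 1, - t, 0, 1:]) =
        (d - lam - 1) * airy_functional t lam (P n * P n)"
      by (simp add: L_simps PV PU)
    moreover have "airy_functional t lam (P n * P n) \<noteq> 0"
      using airy_functional_square_eq_0[OF lam, of t "P n"] lead[of n] by auto
    ultimately show ?thesis
      using lhs airy_functional_pderiv[OF lam, of t "P n * P n"] by simp
  qed

  have r: "ladder_r t lam alpha beta n = beta n * (alpha n + prev alpha n) - real n"
    using n_eq by (simp add: ladder_r_def d_def algebra_simps)
  show ?thesis
    unfolding xdP V_def r poly_eq_poly_eq_iff[symmetric] fun_eq_iff by (simp add: algebra_simps)
qed

theorem theorem3p4: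
  fixes t lam :: real
    and P :: "nat \<Rightarrow> real poly"
    and alpha beta :: "nat \<Rightarrow> real"
  assumes "lam > -1"
    and "airy_orthogonal_polys t lam P"
    and "recurrence_coeffs P alpha beta"
  shows "\<forall>n. \<forall>x. x \<noteq> 0 \<longrightarrow>
    (poly (P n) has_real_derivative
       beta n * ladder_A t alpha beta n x * poly (prev P n) x
       - ladder_B t lam alpha beta n x * poly (P n) x) (at x)"
proof (intro allI impI)
  fix n and x :: real
  assume "x \<noteq> 0"
  have "x * poly (pderiv (P n)) x =
      beta n * (ladder_R t alpha beta n + x * (alpha n + x)) * poly (prev P n) x
      - ladder_r t lam alpha beta n * poly (P n) x - beta n * (x * poly (P n) x)"
    using arg_cong[OF airy_structure_relation[OF assms, of n], of "\<lambda>p. poly p x"]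
    by (simp add: algebra_simps)
  also have "\<dots> = x * (beta n * ladder_A t alpha beta n x * poly (prev P n) x
      - ladder_B t lam alpha beta n x * poly (P n) x)"
    using \<open>x \<noteq> 0\<close> by (simp add: ladder_A_def ladder_B_def divide_simps) (simp add: algebra_simps)
  finally have "poly (pderiv (P n)) x = beta n * ladder_A t alpha beta n x * poly (prev P n) x
      - ladder_B t lam alpha beta n x * poly (P n) x"
    using \<open>x \<noteq> 0\<close> by simp
  then show "(poly (P n) has_real_derivative
      beta n * ladder_A t alpha beta n x * poly (prev P n) x
      - ladder_B t lam alpha beta n x * poly (P n) x) (at x)"
    using poly_DERIV[of "P n" x] by simp
qed

end
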